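(* Let $T>0$ and let $X$ be a Banach space. For $\alpha\in(0,1)$ and $p\in[1,\infty)$, let $q\in(p,p/\alpha)$. Then neither of the following inclusions holds: $$L^q(0,T;X)\subset L^p_\alpha(0,T;X)\quad\text{nor}\quad L^p_\alpha(0,T;X)\subset L^q(0,T;X).$$
   Context: For $\alpha\in(0,1]$ and $p\in[1,\infty)$, $L^p_\alpha(0,T;X)$ is the space of all Bochner measurable functions $v:[0,T]\to X$ such that $\int_0^T\frac{(T-s)^{\alpha-1}}{\Gamma(\alpha)}\|v(s)\|_X^p\,ds<\infty$, where $\Gamma$ is the Gamma function. $L^q(0,T;X)$ is the usual Bochner-Lebesgue space of Bochner measurable functions $v:[0,T]\to X$ with $\|v(\cdot)\|_X\in L^q(0,T;\mathbb{R})$.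
   Formalization: The Banach space X is assumed to be nonzero; for X = {0} both function spaces contain only the zero function, so both inclusions hold and the claim as written fails. *)

theory Defs
  imports "HOL-Analysis.Analysis"
begin

text \<open>
  Bochner (strong) measurability: almost everywhere limit of measurable simple functions. For a
  non-separable codomain this is stronger than Borel measurability, so \<^const>\<open>borel_measurable\<close>
  would not do.
\<close>

definition bochner_measurable :: "'b measure \<Rightarrow> ('b \<Rightarrow> 'a::real_normed_vector) \<Rightarrow> bool"
  where "bochner_measurable M v \<longleftrightarrow>
    (\<exists>g. (\<forall>n. simple_function M (g n)) \<and> (AE s in M. (\<lambda>n. g n s) \<longlonglongrightarrow> v s))"

text \<open>
  A function on \<open>[0,T]\<close> is represented by a total function on \<^typ>\<open>real\<close> whose values outside
  \<open>[0,T]\<close> are irrelevant. The spaces below consist of functions rather than of classes modulo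
  almost everywhere equality; all the membership conditions are invariant under this equality.
\<close>

definition Lq_real :: "real \<Rightarrow> real \<Rightarrow> (real \<Rightarrow> real) set"
  where "Lq_real q T =
    {f \<in> borel_measurable (lebesgue_on {0..T}).
      (\<integral>\<^sup>+ s. ennreal (\<bar>f s\<bar> powr q) \<partial>lebesgue_on {0..T}) < \<infinity>}"

definition Lq_space :: "real \<Rightarrow> real \<Rightarrow> (real \<Rightarrow> 'a::real_normed_vector) set"
  where "Lq_space q T =
    {v. bochner_measurable (lebesgue_on {0..T}) v \<and> (\<lambda>s. norm (v s)) \<in> Lq_real q T}"

text \<open>
  At the single point \<open>s = T\<close> the weight takes the junk value \<open>0 powr (\<alpha> - 1) = 0\<close>, which does not
  affect the integral.
\<close>

definition Lp_weighted :: "real \<Rightarrow> real \<Rightarrow> real \<Rightarrow> (real \<Rightarrow> 'a::real_normed_vector) set"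
  where "Lp_weighted \<alpha> p T =
    {v. bochner_measurable (lebesgue_on {0..T}) v \<and>
        (\<integral>\<^sup>+ s. ennreal ((T - s) powr (\<alpha> - 1) / Gamma \<alpha> * norm (v s) powr p)
           \<partial>lebesgue_on {0..T}) < \<infinity>}"

end

(* Let e be a unit vector. The function (T - s) powr (-alpha / p) e has its singularity at the
   singularity T of the weight: it lies in L^q since alpha q / p < 1, whereas the weighted
   integrand is a multiple of 1 / (T - s). The function s powr (-1 / q) e has its singularity at 0,
   where the weight is bounded: it fails to lie in L^q, but its weighted p-th power is integrable
   since p / q < 1. *)

theory Submission
  imports Defs
begin

text \<open>The substitution \<open>s \<mapsto> T - s\<close> preserves Lebesgue measure and maps
  \<open>{0..T}\<close> onto itself. It moves a singularity at \<open>T\<close> to 0, so that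
  integrals of powers of \<open>T - s\<close> reduce to integrals of powers of
  \<open>s\<close>.\<close>

lemma nn_integral_lebesgue_on_reflect:
  fixes f :: "real \<Rightarrow> ennreal"
  assumes [measurable]: "f \<in> borel_measurable borel"
  shows "(\<integral>\<^sup>+ s. f (T - s) \<partial>lebesgue_on {0..T}) = (\<integral>\<^sup>+ s. f s \<partial>lebesgue_on {0..T})"
proof -
  have "(\<integral>\<^sup>+ s. f s * indicator {0..T} s \<partial>lborel)
      = (\<integral>\<^sup>+ s. f (T - s) * indicator {0..T} (T - s) \<partial>lborel)"
    by (subst nn_integral_real_affine[where c = "-1" and t = T]) auto
  also have "\<dots> = (\<integral>\<^sup>+ s. f (T - s) * indicator {0..T} s \<partial>lborel)"
    by (intro nn_integral_cong) (auto simp: indicator_def)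
  finally show ?thesis
    by (simp add: nn_integral_restrict_space nn_integral_completion)
qed

lemma nn_integral_powr_finite:
  fixes a T :: real
  assumes "-1 < a" "0 \<le> T"
  shows "(\<integral>\<^sup>+ s. ennreal (s powr a) \<partial>lebesgue_on {0..T}) < \<infinity>"
  using nn_integral_has_integral_lebesgue'[OF _ has_integral_powr_from_0[OF assms]]
  by (simp add: nn_integral_restrict_space nn_integral_completion)

text \<open>The logarithm is an antiderivative, so the part of the integral over
  \<open>{d..T}\<close> is \<open>ln T - ln d\<close>, which exceeds every bound as \<open>d\<close>
  tends to 0.\<close>

lemma nn_integral_powr_minus_one:
  fixes T :: real
  assumes "0 < T"
  shows "(\<integral>\<^sup>+ s. ennreal (s powr -1) \<partial>lebesgue_on {0..T}) = \<infinity>" (is "?I = _")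
proof (rule ccontr)
  assume "?I \<noteq> \<infinity>"
  then obtain C where C: "?I = ennreal C" "0 \<le> C"
    by (cases ?I) auto
  \<comment> \<open>Chosen so that \<open>ln T - ln d = C + 1\<close>: the integral over
    \<open>{d..T}\<close> alone then exceeds the supposed total \<open>C\<close>. As
    \<open>C\<close> is nonnegative, \<open>d \<le> T\<close>.\<close>
  define d where "d = T * exp (- C - 1)"
  have d: "0 < d" "d \<le> T"
    using assms C by (auto simp: d_def)
  have "((\<lambda>s. s powr -1) has_integral (ln T - ln d)) {d..T}"
  proof (rule fundamental_theorem_of_calculus)
    fix s assume "s \<in> {d..T}"
    with d have "0 < s" by auto
    then show "(ln has_vector_derivative s powr -1) (at s within {d..T})"
      by (auto intro!: derivative_eq_intros has_vector_derivative_at_within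
          simp: powr_minus_divide simp flip: has_real_derivative_iff_has_vector_derivative)
  qed (use d in auto)
  then have "(\<integral>\<^sup>+ s. ennreal (s powr -1) * indicator {d..T} s \<partial>lborel) = ennreal (ln T - ln d)"
    by (intro nn_integral_has_integral_lebesgue') auto
  moreover have "ln T - ln d = C + 1"
    using assms by (simp add: d_def ln_mult)
  moreover have "(\<integral>\<^sup>+ s. ennreal (s powr -1) * indicator {d..T} s \<partial>lborel)
      \<le> (\<integral>\<^sup>+ s. ennreal (s powr -1) * indicator {0..T} s \<partial>lborel)"
    using d by (intro nn_integral_mono) (auto simp: indicator_def)
  ultimately have "ennreal (C + 1) \<le> ennreal C"
    using C by (simp add: nn_integral_restrict_space nn_integral_completion)
  with \<open>0 \<le> C\<close> show False
    by simp
qed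

text \<open>The two singularities, at 0 and at \<open>T\<close>, are apart. Powers with nonpositive
  exponents decrease, so on each half of the interval the factor that is regular there is at most
  its value at \<open>T / 2\<close>. A sum of two multiples of single powers therefore dominates the
  product.\<close>

lemma nn_integral_beta_finite:
  fixes a b T :: real
  assumes "-1 < a" "a \<le> 0" "-1 < b" "b \<le> 0" "0 < T"
  shows "(\<integral>\<^sup>+ s. ennreal ((T - s) powr a * s powr b) \<partial>lebesgue_on {0..T}) < \<infinity>"
proof -
  let ?M = "lebesgue_on {0..T}"
  define c d where "c = (T / 2) powr a" and "d = (T / 2) powr b"
  have "(\<integral>\<^sup>+ s. ennreal ((T - s) powr a * s powr b) \<partial>?M)
      \<le> (\<integral>\<^sup>+ s. ennreal c * ennreal (s powr b) + ennreal d * ennreal ((T - s) powr a) \<partial>?M)"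
  proof (rule nn_integral_mono)
    fix s assume "s \<in> space ?M"
    then have s: "0 \<le> s" "s \<le> T" by auto
    have "(T - s) powr a * s powr b \<le> c * s powr b + d * (T - s) powr a"
    proof (cases "s \<le> T / 2")
      case True
      then have "(T - s) powr a \<le> c"
        using assms unfolding c_def by (intro powr_mono2') auto
      then show ?thesis
        by (intro add_increasing2 mult_right_mono) (auto simp: d_def)
    next
      case False
      then have "s powr b \<le> d"
        using assms unfolding d_def by (intro powr_mono2') auto
      then have "(T - s) powr a * s powr b \<le> d * (T - s) powr a"
        by (metis mult.commute mult_right_mono powr_ge_zero)
      then show ?thesis
        by (intro add_increasing) (auto simp: c_def)
    qed
    then show "ennreal ((T - s) powr a * s powr b)
        \<le> ennreal c * ennreal (s powr b) + ennreal d * ennreal ((T - s) powr a)"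
      by (simp add: c_def d_def flip: ennreal_mult ennreal_plus)
  qed
  also have "\<dots> = ennreal c * (\<integral>\<^sup>+ s. ennreal (s powr b) \<partial>?M)
      + ennreal d * (\<integral>\<^sup>+ s. ennreal ((T - s) powr a) \<partial>?M)"
    by (simp add: nn_integral_add nn_integral_cmult measurable_restrict_space1
        measurable_completion)
  also have "\<dots> < \<infinity>"
    using assms nn_integral_powr_finite[of a T] nn_integral_powr_finite[of b T]
      nn_integral_lebesgue_on_reflect[of "\<lambda>s. ennreal (s powr a)" T]
    by (simp add: ennreal_mult_less_top)
  finally show ?thesis .
qed

text \<open>Simple real functions converging pointwise to \<open>f\<close> become simple
  vector-valued ones when multiplied by the fixed vector \<open>e\<close>, and scaling is
  continuous.\<close>

lemma bochner_measurable_scaleR_const: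
  fixes f :: "'b \<Rightarrow> real"
  assumes "f \<in> borel_measurable M"
  shows "bochner_measurable M (\<lambda>s. f s *\<^sub>R e)"
proof -
  obtain F where F: "\<And>i. simple_function M (F i)"
      "\<And>s. s \<in> space M \<Longrightarrow> (\<lambda>i. F i s) \<longlonglongrightarrow> f s"
    using borel_measurable_implies_sequence_metric[OF assms, of 0] by metis
  have "simple_function M (\<lambda>s. F i s *\<^sub>R e)" for i
    using simple_function_compose[OF F(1), of "\<lambda>r. r *\<^sub>R e" i] by (simp add: o_def)
  moreover have "AE s in M. (\<lambda>i. F i s *\<^sub>R e) \<longlonglongrightarrow> f s *\<^sub>R e"
    by (intro AE_I2 tendsto_intros F(2))
  ultimately show ?thesis
    unfolding bochner_measurable_def by (intro exI[of _ "\<lambda>i s. F i s *\<^sub>R e"]) auto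
qed

text \<open>A unit vector \<open>e\<close> turns the norm of the product into
  \<open>\<bar>f s\<bar>\<close>, and measurability is automatic. Membership thus becomes a question
  about a scalar integral, here and likewise for the weighted space.\<close>

lemma scaleR_in_Lq_space_iff:
  assumes "f \<in> borel_measurable borel" "norm e = 1"
  shows "(\<lambda>s. f s *\<^sub>R e) \<in> Lq_space q T \<longleftrightarrow>
    (\<integral>\<^sup>+ s. ennreal (\<bar>f s\<bar> powr q) \<partial>lebesgue_on {0..T}) < \<infinity>"
proof -
  have "f \<in> borel_measurable (lebesgue_on {0..T})"
    using assms(1) by (simp add: measurable_restrict_space1 measurable_completion)
  with assms(2) show ?thesis
    by (simp add: Lq_space_def Lq_real_def bochner_measurable_scaleR_const)
qed

lemma scaleR_in_Lp_weighted_iff: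
  assumes "f \<in> borel_measurable borel" "norm e = 1"
  shows "(\<lambda>s. f s *\<^sub>R e) \<in> Lp_weighted \<alpha> p T \<longleftrightarrow>
    (\<integral>\<^sup>+ s. ennreal ((T - s) powr (\<alpha> - 1) / Gamma \<alpha> * \<bar>f s\<bar> powr p)
      \<partial>lebesgue_on {0..T}) < \<infinity>"
proof -
  have "f \<in> borel_measurable (lebesgue_on {0..T})"
    using assms(1) by (simp add: measurable_restrict_space1 measurable_completion)
  with assms(2) show ?thesis
    by (simp add: Lp_weighted_def bochner_measurable_scaleR_const)
qed

theorem theorem27:
  fixes T \<alpha> p q :: real
  assumes "T > 0"
    and "\<exists>x::'a::banach. x \<noteq> 0"
    and "0 < \<alpha>" and "\<alpha> < 1"
    and "1 \<le> p"
    and "p < q" and "q < p / \<alpha>"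
  shows "\<not> (Lq_space q T :: (real \<Rightarrow> 'a) set) \<subseteq> Lp_weighted \<alpha> p T \<and>
         \<not> (Lp_weighted \<alpha> p T :: (real \<Rightarrow> 'a) set) \<subseteq> Lq_space q T"
proof -
  let ?M = "lebesgue_on {0..T}"
  define G where "G = inverse (Gamma \<alpha>)"
  have G: "0 < G"
    using assms by (simp add: G_def Gamma_real_pos)
  obtain e :: 'a where e: "norm e = 1"
    using assms(2) by (metis norm_sgn)
  \<comment> \<open>The normalising factor \<open>1 / Gamma \<alpha>\<close> is positive and finite,
    so once pulled out it does not affect whether the integral is finite.\<close>
  have weighted: "(\<integral>\<^sup>+ s. ennreal ((T - s) powr (\<alpha> - 1) / Gamma \<alpha> * g s) \<partial>?M)
      = ennreal G * (\<integral>\<^sup>+ s. ennreal ((T - s) powr (\<alpha> - 1) * g s) \<partial>?M)"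
    if "g \<in> borel_measurable borel" "\<And>s. 0 \<le> g s" for g :: "real \<Rightarrow> real"
  proof -
    have "(\<lambda>s. ennreal ((T - s) powr (\<alpha> - 1) * g s)) \<in> borel_measurable ?M"
      using that(1) by (intro measurable_restrict_space1 measurable_completion) simp
    then show ?thesis
      using G that(2)
      by (simp add: G_def field_simps flip: nn_integral_cmult ennreal_mult)
  qed

  define v where "v = (\<lambda>s. (T - s) powr (- \<alpha> / p))"
  have [measurable]: "v \<in> borel_measurable borel"
    by (simp add: v_def)
  \<comment> \<open>This is the upper bound \<open>q < p / \<alpha>\<close>, which makes the
    reflected power integrable at 0.\<close>
  have "-1 < - \<alpha> / p * q"
    using assms by (simp add: field_simps)
  then have "(\<integral>\<^sup>+ s. ennreal (\<bar>v s\<bar> powr q) \<partial>?M) < \<infinity>"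
    using nn_integral_powr_finite[of "- \<alpha> / p * q" T] \<open>T > 0\<close>
      nn_integral_lebesgue_on_reflect[of "\<lambda>s. ennreal (s powr (- \<alpha> / p * q))" T]
    by (simp add: v_def powr_powr)
  then have v_Lq: "(\<lambda>s. v s *\<^sub>R e) \<in> Lq_space q T"
    using e by (simp add: scaleR_in_Lq_space_iff)
  \<comment> \<open>The exponents add up to \<open>(\<alpha> - 1) - \<alpha>\<close>. At
    \<open>s = T\<close> both sides are 0, because \<open>0 powr x = 0\<close>.\<close>
  have "(T - s) powr (\<alpha> - 1) * \<bar>v s\<bar> powr p = (T - s) powr -1" for s
    using assms by (simp add: v_def powr_powr flip: powr_add)
  then have "(\<integral>\<^sup>+ s. ennreal ((T - s) powr (\<alpha> - 1) / Gamma \<alpha> * \<bar>v s\<bar> powr p) \<partial>?M)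
      = ennreal G * (\<integral>\<^sup>+ s. ennreal ((T - s) powr -1) \<partial>?M)"
    by (subst weighted) simp_all
  \<comment> \<open>Positivity of \<open>G\<close> matters: in \<open>ennreal\<close>,
    \<open>0 * \<infinity>\<close> would be 0.\<close>
  also have "\<dots> = \<infinity>"
    using nn_integral_powr_minus_one[OF \<open>T > 0\<close>] G
      nn_integral_lebesgue_on_reflect[of "\<lambda>s. ennreal (s powr -1)" T]
    by (simp add: ennreal_mult_top)
  finally have "(\<integral>\<^sup>+ s. ennreal ((T - s) powr (\<alpha> - 1) / Gamma \<alpha> * \<bar>v s\<bar> powr p) \<partial>?M) = \<infinity>" .
  then have "(\<lambda>s. v s *\<^sub>R e) \<notin> Lp_weighted \<alpha> p T"
    using e by (simp add: scaleR_in_Lp_weighted_iff)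
  with v_Lq have 1: "\<not> (Lq_space q T :: (real \<Rightarrow> 'a) set) \<subseteq> Lp_weighted \<alpha> p T"
    by blast

  define w :: "real \<Rightarrow> real" where "w = (\<lambda>s. s powr (-1 / q))"
  have [measurable]: "w \<in> borel_measurable borel"
    by (simp add: w_def)
  have "(\<integral>\<^sup>+ s. ennreal (\<bar>w s\<bar> powr q) \<partial>?M) = \<infinity>"
    using nn_integral_powr_minus_one[OF \<open>T > 0\<close>] assms by (simp add: w_def powr_powr)
  then have "(\<lambda>s. w s *\<^sub>R e) \<notin> Lq_space q T"
    using e by (simp add: scaleR_in_Lq_space_iff)
  \<comment> \<open>The exponents \<open>\<alpha> - 1\<close> at \<open>T\<close> and
    \<open>- p / q\<close> at 0 both exceed -1, by \<open>0 < \<alpha>\<close> and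
    \<open>p < q\<close> respectively.\<close>
  moreover have "(\<integral>\<^sup>+ s. ennreal ((T - s) powr (\<alpha> - 1) * \<bar>w s\<bar> powr p) \<partial>?M) < \<infinity>"
    using nn_integral_beta_finite[of "\<alpha> - 1" "- p / q" T] assms
    by (simp add: w_def powr_powr)
  then have "(\<lambda>s. w s *\<^sub>R e) \<in> Lp_weighted \<alpha> p T"
    using e by (simp add: scaleR_in_Lp_weighted_iff weighted ennreal_mult_less_top
        del: times_divide_eq_left)
  ultimately have 2: "\<not> (Lp_weighted \<alpha> p T :: (real \<Rightarrow> 'a) set) \<subseteq> Lq_space q T"
    by blast
  from 1 2 show ?thesis ..
qed

end
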